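(* Let $\mu$ be a Borel probability measure on $\mathbb{R}^d$ and let $\mathcal{B}=(B_n=B(x_n,r_n))_{n\in\mathbb{N}}$ be a sequence of balls of $\mathbb{R}^d$ with $\lim_{n\to+\infty} r_n=0$. (1) If $\mathcal{B}$ is $\mu$-a.c., then $\mu(\limsup_{n\to+\infty}B_n)=1$. (2) If there exists $0\le v<1$ such that $\mu(\limsup_{n\to+\infty}(vB_n))=1$, then $\mathcal{B}$ is $\mu$-a.c.
   Context: $\mathbb{N}$ includes $0$. $B(x,r)$ ($r>0$) is the closed ball of $(\mathbb{R}^d,\|\cdot\|_\infty)$ of center $x$ and radius $r$; for $t\ge 0$ and $B=B(x,r)$, $tB=B(x,tr)$. For sets $A_n$, $\limsup_{n\to+\infty}A_n=\bigcap_{g}\bigcup_{n\ge g}A_n$. A sequence of balls $(B_n)_{n\in\mathbb{N}}$ is $\mu$-asymptotically covering ($\mu$-a.c.) if there is a constant $C>0$ such that for every open set $\Omega\subset\mathbb{R}^d$ and every $g\in\mathbb{N}$ there are $N_\Omega\in\mathbb{N}$ (possibly $0$, i.e. the empty family) and integers $g\le n_1\le\dots\le n_{N_\Omega}$ such that: $B_{n_i}\subset\Omega$ for all $1\le i\le N_\Omega$; $B_{n_i}\cap B_{n_j}=\emptyset$ for all $1\le i\ne j\le N_\Omega$; and $\mu\big(\bigcup_{1\le i\le N_\Omega}B_{n_i}\big)\ge C\mu(\Omega)$. *)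

theory Defs
  imports "HOL-Probability.Probability"
begin

text \<open>
  Closed ball of \<open>\<real>\<^sup>d\<close> for the supremum norm, which is \<^const>\<open>infnorm\<close> (\<^const>\<open>cball\<close> is
  Euclidean). The dilate \<open>tB\<close> of \<open>B = sup_cball x r\<close> is \<open>sup_cball x (t * r)\<close>; for
  \<open>t = 0\<close> this is the singleton \<open>{x}\<close>.
\<close>

definition sup_cball :: "real ^ 'd \<Rightarrow> real \<Rightarrow> (real ^ 'd) set" where
  "sup_cball x r = {y. infnorm (y - x) \<le> r}"

text \<open>
  The extracted indices are \<open>n 1 \<le> \<dots> \<le> n N\<close>; the values of \<open>n\<close> outside \<open>{1..N}\<close> are
  irrelevant, and \<open>N = 0\<close> is the empty family. The measure is meant to be finite, since
  \<^const>\<open>measure\<close> is \<open>0\<close> on sets of infinite measure.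
\<close>

definition asymptotically_covering ::
  "(real ^ 'd) measure \<Rightarrow> (nat \<Rightarrow> (real ^ 'd) set) \<Rightarrow> bool" where
  "asymptotically_covering \<mu> B \<longleftrightarrow>
    (\<exists>C>0. \<forall>\<Omega>. open \<Omega> \<longrightarrow> (\<forall>g. \<exists>N. \<exists>n :: nat \<Rightarrow> nat.
       (\<forall>i\<in>{1..N}. g \<le> n i) \<and> mono_on {1..N} n \<and>
       (\<forall>i\<in>{1..N}. B (n i) \<subseteq> \<Omega>) \<and>
       (\<forall>i\<in>{1..N}. \<forall>j\<in>{1..N}. i \<noteq> j \<longrightarrow> B (n i) \<inter> B (n j) = {}) \<and>
       measure \<mu> (\<Union>i\<in>{1..N}. B (n i)) \<ge> C * measure \<mu> \<Omega>))"

end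

theory Submission
  imports Defs "HOL-Library.Ramsey"
begin

text \<open>
  Write \<open>B\<^sub>n\<close> for the given cubes and \<open>vB\<^sub>n\<close> for their concentric dilates by \<open>v\<close>.

  An asymptotically covering sequence has an upper limit of full measure because otherwise, for
  some \<open>g\<close>, the complement \<open>E\<close> of the tail union of the \<open>B\<^sub>n\<close>, \<open>n \<ge> g\<close>, has positive measure. By
  outer regularity \<open>E\<close> lies in an open set \<open>V\<close> with \<open>\<mu> (V - E) < C \<mu> E\<close>; but the cubes of index at
  least \<open>g\<close> extracted inside \<open>V\<close> avoid \<open>E\<close> and have total measure at least \<open>C \<mu> V\<close>
  (\<open>asymptotically_covering_imp_limsup\<close>).

  For the converse, the measure \<open>\<mu>\<close> is not assumed to be doubling, so a covering theorem of
  Besicovitch type is needed. If the upper limit of the \<open>vB\<^sub>n\<close> has full measure, finitely many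
  \<open>vB\<^sub>n\<close> with \<open>n \<ge> g\<close> and \<open>B\<^sub>n \<subseteq> \<Omega>\<close> already carry at least half of the measure of \<open>\<Omega>\<close>
  (\<open>finite_subfamily_half_measure\<close>). The proposition \<open>finite_Besicovitch_dilated\<close> selects among them
  cubes \<open>B\<^sub>n\<close> which cover the union of these \<open>vB\<^sub>n\<close> and which split into \<open>Q\<close> disjoint families,
  where \<open>Q\<close> depends only on \<open>v\<close> and the dimension; the heaviest family has measure at least
  \<open>\<mu> \<Omega> / (2 Q)\<close>.

  The selection is greedy, by decreasing radius: a cube is kept when its dilate is not covered by
  the cubes kept before, and it is given a colour not used by the earlier cubes that it meets. What
  has to be bounded is the number of these earlier cubes (\<open>large_cubes_meeting_small_cube\<close>). Of two
  kept cubes, the smaller one, of radius \<open>\<rho>\<close>, has a point of its dilate outside the larger one, so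
  it sticks out by more than \<open>(1 - v) \<rho>\<close> beyond one of the \<open>2 d\<close> faces of the larger one. By
  Ramsey's theorem, many cubes contain a large subfamily in which this is always the face in the
  same direction. In such a subfamily the cube whose face lies farthest out is the smallest one.
  Since all the cubes meet a given cube that is no larger, this confines all the face coordinates
  to an interval whose length is at most four times the smallest radius, while they are separated
  by more than \<open>1 - v\<close> times that radius (\<open>card_nested_scales_le\<close>).
\<close>

section \<open>A bounded number of large cubes near a small one\<close>

text \<open>
  Ramsey's theorem for pairs, in a form where the colours are given by finitely many relations which
  may overlap and need not be symmetric: every pair is related, in some order, by at least one of
  them. The bound \<open>N\<close> depends only on \<open>L\<close> and on the number of relations.
\<close>

lemma Ramsey_covering_relations:
  fixes L :: nat
  obtains N :: nat where
    "\<And>(V :: 'a set) (R :: 'k::finite \<Rightarrow> 'a \<Rightarrow> 'a \<Rightarrow> bool).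
       finite V \<Longrightarrow> N \<le> card V \<Longrightarrow>
       (\<And>a b. a \<in> V \<Longrightarrow> b \<in> V \<Longrightarrow> a \<noteq> b \<Longrightarrow> \<exists>k. R k a b \<or> R k b a) \<Longrightarrow>
       \<exists>k. \<exists>H\<subseteq>V. card H = L \<and> (\<forall>a\<in>H. \<forall>b\<in>H. a \<noteq> b \<longrightarrow> R k a b \<or> R k b a)"
proof -
  obtain N :: nat where N: "partn_lst {..<N} (replicate CARD('k) L) 2"
    using ramsey_full by blast
  obtain e where e: "bij_betw e (UNIV :: 'k set) {0..<CARD('k)}"
    using ex_bij_betw_finite_nat[OF finite_class.finite_UNIV] by blast
  have e_less: "e k < CARD('k)" for k
    using bij_betwE[OF e] by auto
  have "\<exists>k. \<exists>H\<subseteq>V. card H = L \<and> (\<forall>a\<in>H. \<forall>b\<in>H. a \<noteq> b \<longrightarrow> R k a b \<or> R k b a)"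
    if V: "finite V" "N \<le> card V"
      and R: "\<And>a b. a \<in> V \<Longrightarrow> b \<in> V \<Longrightarrow> a \<noteq> b \<Longrightarrow> \<exists>k. R k a b \<or> R k b a"
    for V :: "'a set" and R :: "'k \<Rightarrow> 'a \<Rightarrow> 'a \<Rightarrow> bool"
  proof -
    obtain h where h: "bij_betw h {0..<card V} V"
      using ex_bij_betw_nat_finite[OF V(1)] by blast
    have hV: "h i \<in> V" if "i < N" for i
      using bij_betwE[OF h] V(2) that by auto
    have h_inj: "h i \<noteq> h j" if "i < N" "j < N" "i \<noteq> j" for i j
      using bij_betw_imp_inj_on[OF h] V(2) that by (auto simp: inj_on_def)
    define P where "P k X \<longleftrightarrow> (\<forall>i\<in>X. \<forall>j\<in>X. i \<noteq> j \<longrightarrow> R k (h i) (h j) \<or> R k (h j) (h i))"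
      for k X
    define f where "f X = e (SOME k. P k X)" for X
    have P: "P (SOME k. P k X) X" if Xm: "X \<in> [{..<N}]\<^bsup>2\<^esup>" for X
    proof -
      obtain i j where X: "X = {i, j}" "i < N" "j < N" "i \<noteq> j"
        using Xm by (elim nsets2_E) auto
      obtain k where "R k (h i) (h j) \<or> R k (h j) (h i)"
        using R[OF hV hV h_inj] X by blast
      then have "P k X"
        unfolding P_def X(1) by blast
      then show ?thesis by (rule someI)
    qed
    have "f \<in> [{..<N}]\<^bsup>2\<^esup> \<rightarrow> {..<CARD('k)}"
      using e_less by (auto simp: f_def)
    then obtain i H where i: "i < CARD('k)" and H: "H \<in> nsets {..<N} L"
      and mono: "f ` [H]\<^bsup>2\<^esup> \<subseteq> {i}"
      using N unfolding partn_lst_def monochromatic_def by fastforce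
    obtain k where k: "e k = i"
      using e i unfolding bij_betw_def by (metis atLeast0LessThan imageE lessThan_iff)
    have HN: "H \<subseteq> {..<N}" and cardH: "card H = L"
      using H by (auto simp: nsets_def)
    have "R k (h a) (h b) \<or> R k (h b) (h a)" if ab: "a \<in> H" "b \<in> H" "a \<noteq> b" for a b
    proof -
      have X: "{a, b} \<in> [H]\<^bsup>2\<^esup>"
        using ab by simp
      then have "e (SOME k. P k {a, b}) = e k"
        using mono k unfolding f_def by blast
      then have "(SOME k. P k {a, b}) = k"
        using bij_betw_imp_inj_on[OF e] by (simp add: inj_on_def)
      moreover have "{a, b} \<in> [{..<N}]\<^bsup>2\<^esup>"
        using X nsets_mono[OF HN] by blast
      ultimately have "P k {a, b}"
        using P by metis
      then show ?thesis
        using ab unfolding P_def by blast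
    qed
    moreover have "card (h ` H) = L"
      using cardH h_inj HN by (subst card_image) (auto simp: inj_on_def)
    moreover have "h ` H \<subseteq> V"
      using hV HN by auto
    ultimately show ?thesis
      by (intro exI[of _ k] exI[of _ "h ` H"]) auto
  qed
  then show ?thesis
    by (rule that)
qed

text \<open>
  The one-dimensional estimate. Here \<open>F a\<close> is the coordinate of a face of a cube of radius \<open>r a\<close>
  that meets a cube with centre coordinate \<open>p\<close> and radius \<open>s \<le> r a\<close>. The element with the largest
  value of \<open>F\<close> has the smallest value of \<open>r\<close>, so the radii may differ by arbitrarily large factors
  without any loss.
\<close>

lemma card_nested_scales_le:
  fixes F r :: "'a \<Rightarrow> real"
  assumes "finite H" "0 < c" "0 < s"
    and rs: "\<And>a. a \<in> H \<Longrightarrow> s \<le> r a"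
    and lo: "\<And>a. a \<in> H \<Longrightarrow> p - s \<le> F a"
    and hi: "\<And>a. a \<in> H \<Longrightarrow> F a \<le> p + s + 2 * r a"
    and step: "\<And>a b. a \<in> H \<Longrightarrow> b \<in> H \<Longrightarrow> a \<noteq> b \<Longrightarrow>
      (r b \<le> r a \<and> F a + c * r b < F b) \<or> (r a \<le> r b \<and> F b + c * r a < F a)"
  shows "card H \<le> Suc (nat \<lfloor>4 / c\<rfloor>)"
proof (cases "H = {}")
  case False
  have "Max (F ` H) \<in> F ` H"
    using False \<open>finite H\<close> by simp
  then obtain m where m_Max: "Max (F ` H) = F m" and m_H: "m \<in> H"
    by (rule imageE)
  have m: "F a \<le> F m" if "a \<in> H" for a
    unfolding m_Max[symmetric] using that \<open>finite H\<close> by simp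
  have rpos: "0 < r a" if "a \<in> H" for a
    using rs[OF that] \<open>0 < s\<close> by linarith
  have rm: "r m \<le> r a" if "a \<in> H" for a
  proof (cases "a = m")
    case False
    have "0 < c * r a"
      using rpos[OF that] \<open>0 < c\<close> by simp
    then show ?thesis
      using step[OF that m_H False] m[OF that] by linarith
  qed simp
  define \<delta> where "\<delta> = c * r m"
  have \<delta>: "0 < \<delta>"
    using rpos[OF m_H] \<open>0 < c\<close> by (simp add: \<delta>_def)
  have sep: "\<delta> < \<bar>F a - F b\<bar>" if "a \<in> H" "b \<in> H" "a \<noteq> b" for a b
  proof -
    have "\<delta> \<le> c * r a" "\<delta> \<le> c * r b"
      using rm that \<open>0 < c\<close> by (auto simp: \<delta>_def)
    then show ?thesis
      using step[OF that] by linarith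
  qed
  define u where "u a = (F a - (p - s)) / \<delta>" for a
  have u: "0 \<le> u a" "u a \<le> 4 / c" if "a \<in> H" for a
  proof -
    show "0 \<le> u a"
      using lo[OF that] \<delta> by (simp add: u_def)
    have "F a - (p - s) \<le> 4 * r m"
      using m[OF that] hi[OF m_H] rs[OF m_H] by linarith
    then have "u a \<le> 4 * r m / \<delta>"
      using \<delta> by (simp add: u_def divide_right_mono)
    also have "\<dots> = 4 / c"
      using rpos[OF m_H] by (simp add: \<delta>_def)
    finally show "u a \<le> 4 / c" .
  qed
  have "inj_on (\<lambda>a. nat \<lfloor>u a\<rfloor>) H"
  proof (rule inj_onI, rule ccontr)
    fix a b
    assume ab: "a \<in> H" "b \<in> H" "nat \<lfloor>u a\<rfloor> = nat \<lfloor>u b\<rfloor>" "a \<noteq> b"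
    have "0 \<le> \<lfloor>u a\<rfloor>" "0 \<le> \<lfloor>u b\<rfloor>"
      using u(1) ab by simp_all
    then have "\<lfloor>u a\<rfloor> = \<lfloor>u b\<rfloor>"
      using ab(3) by linarith
    then have "\<bar>u a - u b\<bar> < 1"
      by linarith
    moreover have "u a - u b = (F a - F b) / \<delta>"
      by (simp add: u_def diff_divide_distrib)
    ultimately have "\<bar>F a - F b\<bar> < \<delta>"
      using \<delta> by (simp add: abs_divide)
    then show False
      using sep[OF ab(1,2,4)] by linarith
  qed
  then have "card H = card ((\<lambda>a. nat \<lfloor>u a\<rfloor>) ` H)"
    by (simp add: card_image)
  also have "\<dots> \<le> card {..nat \<lfloor>4 / c\<rfloor>}"
    using u by (intro card_mono) (auto intro!: nat_mono floor_mono)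
  finally show ?thesis by simp
qed simp

lemma mem_sup_cball_iff: "y \<in> sup_cball x r \<longleftrightarrow> (\<forall>i. \<bar>y $ i - x $ i\<bar> \<le> r)"
proof
  assume "y \<in> sup_cball x r"
  then show "\<forall>i. \<bar>y $ i - x $ i\<bar> \<le> r"
    using component_le_infnorm_cart[of "y - x"]
    by (auto simp: sup_cball_def intro: order_trans)
next
  assume "\<forall>i. \<bar>y $ i - x $ i\<bar> \<le> r"
  then show "y \<in> sup_cball x r"
    unfolding sup_cball_def mem_Collect_eq infnorm_cart by (intro cSup_least) auto
qed

text \<open>
  The bound \<open>Q\<close> does not depend on the ratio of the radii to \<open>s\<close>. The hypothesis on pairs is stated
  symmetrically because equal radii leave the order of selection undetermined.
\<close>

lemma large_cubes_meeting_small_cube: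
  fixes v :: real
  assumes v: "v < 1"
  obtains Q :: nat where
    "\<And>(x :: 'a \<Rightarrow> real ^ 'd) r J z s.
       finite J \<Longrightarrow> 0 < s \<Longrightarrow> (\<And>j. j \<in> J \<Longrightarrow> s \<le> r j) \<Longrightarrow>
       (\<And>j. j \<in> J \<Longrightarrow> sup_cball (x j) (r j) \<inter> sup_cball z s \<noteq> {}) \<Longrightarrow>
       (\<And>a b. a \<in> J \<Longrightarrow> b \<in> J \<Longrightarrow> a \<noteq> b \<Longrightarrow>
          (r b \<le> r a \<and> \<not> sup_cball (x b) (v * r b) \<subseteq> sup_cball (x a) (r a)) \<or>
          (r a \<le> r b \<and> \<not> sup_cball (x a) (v * r a) \<subseteq> sup_cball (x b) (r b))) \<Longrightarrow>
       card J < Q"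
proof -
  define c where "c = 1 - v"
  have c: "0 < c"
    using v by (simp add: c_def)
  define L where "L = Suc (Suc (nat \<lfloor>4 / c\<rfloor>))"
  define \<sigma> :: "bool \<Rightarrow> real" where "\<sigma> t = (if t then 1 else -1)" for t
  obtain Q :: nat where Q: "\<And>(V :: 'a set) (R :: 'd \<times> bool \<Rightarrow> 'a \<Rightarrow> 'a \<Rightarrow> bool).
       finite V \<Longrightarrow> Q \<le> card V \<Longrightarrow>
       (\<And>a b. a \<in> V \<Longrightarrow> b \<in> V \<Longrightarrow> a \<noteq> b \<Longrightarrow> \<exists>k. R k a b \<or> R k b a) \<Longrightarrow>
       \<exists>k. \<exists>H\<subseteq>V. card H = L \<and> (\<forall>a\<in>H. \<forall>b\<in>H. a \<noteq> b \<longrightarrow> R k a b \<or> R k b a)"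
    by (rule Ramsey_covering_relations[where L = L]) (erule that)
  have "card J < Q"
    if J: "finite J" "0 < s" and rs: "\<And>j. j \<in> J \<Longrightarrow> s \<le> r j"
      and meet: "\<And>j. j \<in> J \<Longrightarrow> sup_cball (x j) (r j) \<inter> sup_cball z s \<noteq> {}"
      and esc: "\<And>a b. a \<in> J \<Longrightarrow> b \<in> J \<Longrightarrow> a \<noteq> b \<Longrightarrow>
          (r b \<le> r a \<and> \<not> sup_cball (x b) (v * r b) \<subseteq> sup_cball (x a) (r a)) \<or>
          (r a \<le> r b \<and> \<not> sup_cball (x a) (v * r a) \<subseteq> sup_cball (x b) (r b))"
    for x :: "'a \<Rightarrow> real ^ 'd" and r J z s
  proof (rule ccontr)
    assume "\<not> card J < Q"
    \<comment> \<open>A direction \<open>k\<close> is a coordinate \<open>fst k\<close> with an orientation \<open>snd k\<close>; \<open>F k a\<close> is the position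
      of the corresponding face of the \<open>a\<close>-th cube along this oriented axis.\<close>
    define F where "F k a = \<sigma> (snd k) * x a $ fst k + r a" for k a
    define R where "R k a b \<longleftrightarrow> r b \<le> r a \<and> F k a + c * r b < F k b" for k a b
    have esc_face: "\<exists>k. F k a + c * r b < F k b"
      if "\<not> sup_cball (x b) (v * r b) \<subseteq> sup_cball (x a) (r a)" for a b
    proof -
      obtain y i where y: "\<And>i. \<bar>y $ i - x b $ i\<bar> \<le> v * r b" and i: "r a < \<bar>y $ i - x a $ i\<bar>"
        using \<open>\<not> _ \<subseteq> _\<close> by (auto simp: subset_iff mem_sup_cball_iff not_le)
      have "F (i, x a $ i < y $ i) a + c * r b < F (i, x a $ i < y $ i) b"
        using y[of i] i by (auto simp: F_def \<sigma>_def c_def algebra_simps abs_if split: if_splits)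
      then show ?thesis ..
    qed
    have "\<exists>k. R k a b \<or> R k b a" if "a \<in> J" "b \<in> J" "a \<noteq> b" for a b
      using esc[OF that] esc_face unfolding R_def by blast
    then obtain k H where H: "H \<subseteq> J" "card H = L"
      and hom: "\<And>a b. a \<in> H \<Longrightarrow> b \<in> H \<Longrightarrow> a \<noteq> b \<Longrightarrow> R k a b \<or> R k b a"
      using Q[of J R] J(1) \<open>\<not> card J < Q\<close> by (metis not_le)
    define p where "p = \<sigma> (snd k) * z $ fst k"
    have F: "p - s \<le> F k a" "F k a \<le> p + s + 2 * r a" if "a \<in> H" for a
    proof -
      have "sup_cball (x a) (r a) \<inter> sup_cball z s \<noteq> {}"
        using meet H(1) that by blast
      then obtain y where "\<bar>y $ fst k - x a $ fst k\<bar> \<le> r a" "\<bar>y $ fst k - z $ fst k\<bar> \<le> s"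
        unfolding mem_sup_cball_iff disjoint_iff by blast
      then show "p - s \<le> F k a" "F k a \<le> p + s + 2 * r a"
        by (auto simp: p_def F_def \<sigma>_def abs_if split: if_splits)
    qed
    have "card H \<le> Suc (nat \<lfloor>4 / c\<rfloor>)"
    proof (rule card_nested_scales_le[where F = "F k" and r = r and p = p and s = s])
      show "finite H"
        using H(1) J(1) finite_subset by blast
      show "s \<le> r a" if "a \<in> H" for a
        using rs H(1) that by blast
    qed (use c J(2) F hom in \<open>auto simp: R_def\<close>)
    then show False
      using H(2) by (simp add: L_def)
  qed
  then show ?thesis
    by (rule that)
qed

section \<open>A covering theorem of Besicovitch type for finite families of cubes\<close>

text \<open>
  Unlike in Besicovitch's theorem, the points to be covered are not the centres only but all the
  points of the cubes shrunk by the factor \<open>v\<close>. The function \<open>f\<close> is the colouring of the selected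
  cubes, with disjoint cubes in each colour class.
\<close>

proposition finite_Besicovitch_dilated:
  fixes v :: real
  assumes v: "v < 1"
  obtains Q :: nat where
    "\<And>(x :: 'a \<Rightarrow> real ^ 'd) r I.
       finite I \<Longrightarrow> (\<And>i. i \<in> I \<Longrightarrow> 0 < r i) \<Longrightarrow>
       \<exists>J\<subseteq>I. \<exists>f :: 'a \<Rightarrow> nat. f ` J \<subseteq> {..<Q} \<and>
         (\<Union>i\<in>I. sup_cball (x i) (v * r i)) \<subseteq> (\<Union>j\<in>J. sup_cball (x j) (r j)) \<and>
         (\<forall>a\<in>J. \<forall>b\<in>J. a \<noteq> b \<longrightarrow> f a = f b \<longrightarrow>
            sup_cball (x a) (r a) \<inter> sup_cball (x b) (r b) = {})"
    "0 < Q"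
proof -
  obtain Q :: nat where Q:
    "\<And>(x :: 'a \<Rightarrow> real ^ 'd) r J z s.
       finite J \<Longrightarrow> 0 < s \<Longrightarrow> (\<And>j. j \<in> J \<Longrightarrow> s \<le> r j) \<Longrightarrow>
       (\<And>j. j \<in> J \<Longrightarrow> sup_cball (x j) (r j) \<inter> sup_cball z s \<noteq> {}) \<Longrightarrow>
       (\<And>a b. a \<in> J \<Longrightarrow> b \<in> J \<Longrightarrow> a \<noteq> b \<Longrightarrow>
          (r b \<le> r a \<and> \<not> sup_cball (x b) (v * r b) \<subseteq> sup_cball (x a) (r a)) \<or>
          (r a \<le> r b \<and> \<not> sup_cball (x a) (v * r a) \<subseteq> sup_cball (x b) (r b))) \<Longrightarrow>
       card J < Q"
    by (rule large_cubes_meeting_small_cube[OF v]) (erule that)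
  have "\<exists>J\<subseteq>I. \<exists>f :: 'a \<Rightarrow> nat. f ` J \<subseteq> {..<Q} \<and>
         (\<Union>i\<in>I. sup_cball (x i) (v * r i)) \<subseteq> (\<Union>j\<in>J. sup_cball (x j) (r j)) \<and>
         (\<forall>a\<in>J. \<forall>b\<in>J. a \<noteq> b \<longrightarrow> f a = f b \<longrightarrow>
            sup_cball (x a) (r a) \<inter> sup_cball (x b) (r b) = {})"
    if "finite I" "\<And>i. i \<in> I \<Longrightarrow> 0 < r i"
    for x :: "'a \<Rightarrow> real ^ 'd" and r I
  proof -
    let ?B = "\<lambda>i. sup_cball (x i) (r i)" and ?V = "\<lambda>i. sup_cball (x i) (v * r i)"
    have "(\<forall>i\<in>I. 0 < r i) \<longrightarrow> (\<exists>J\<subseteq>I. \<exists>f :: 'a \<Rightarrow> nat. f ` J \<subseteq> {..<Q} \<and>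
         (\<Union>i\<in>I. ?V i) \<subseteq> (\<Union>j\<in>J. ?B j) \<and>
         (\<forall>a\<in>J. \<forall>b\<in>J. a \<noteq> b \<longrightarrow> f a = f b \<longrightarrow> ?B a \<inter> ?B b = {}) \<and>
         (\<forall>a\<in>J. \<forall>b\<in>J. a \<noteq> b \<longrightarrow>
            (r b \<le> r a \<and> \<not> ?V b \<subseteq> ?B a) \<or> (r a \<le> r b \<and> \<not> ?V a \<subseteq> ?B b)))"
      using \<open>finite I\<close>
    \<comment> \<open>The cubes are processed in order of decreasing radius. The last clause, on the pairs of
      selected cubes, is what bounds the number of colours.\<close>
    proof (induction I rule: finite_ranking_induct[where f = "\<lambda>i. - r i"])
      case (insert n I)
      show ?case
      proof
        assume pos: "\<forall>i\<in>insert n I. 0 < r i"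
        then obtain J and f :: "'a \<Rightarrow> nat" where J: "J \<subseteq> I" and f: "f ` J \<subseteq> {..<Q}"
          and cov: "(\<Union>i\<in>I. ?V i) \<subseteq> (\<Union>j\<in>J. ?B j)"
          and disj: "\<forall>a\<in>J. \<forall>b\<in>J. a \<noteq> b \<longrightarrow> f a = f b \<longrightarrow> ?B a \<inter> ?B b = {}"
          and esc: "\<forall>a\<in>J. \<forall>b\<in>J. a \<noteq> b \<longrightarrow>
            (r b \<le> r a \<and> \<not> ?V b \<subseteq> ?B a) \<or> (r a \<le> r b \<and> \<not> ?V a \<subseteq> ?B b)"
          using insert.IH by auto
        show "\<exists>J\<subseteq>insert n I. \<exists>f :: 'a \<Rightarrow> nat. f ` J \<subseteq> {..<Q} \<and>
         (\<Union>i\<in>insert n I. ?V i) \<subseteq> (\<Union>j\<in>J. ?B j) \<and>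
         (\<forall>a\<in>J. \<forall>b\<in>J. a \<noteq> b \<longrightarrow> f a = f b \<longrightarrow> ?B a \<inter> ?B b = {}) \<and>
         (\<forall>a\<in>J. \<forall>b\<in>J. a \<noteq> b \<longrightarrow>
            (r b \<le> r a \<and> \<not> ?V b \<subseteq> ?B a) \<or> (r a \<le> r b \<and> \<not> ?V a \<subseteq> ?B b))"
        proof (cases "?V n \<subseteq> (\<Union>j\<in>J. ?B j)")
          case True
          show ?thesis
            by (rule exI[of _ J], intro conjI exI[of _ f])
               (use True J f cov disj esc in blast)+
        next
          case False
          \<comment> \<open>The selected cubes that meet the new one, whose colours are forbidden for it.\<close>
          define M where "M = {j \<in> J. ?B j \<inter> ?B n \<noteq> {}}"
          have rn: "r n \<le> r j" if "j \<in> J" for j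
            using insert.hyps(2)[of j] J that by auto
          have finM: "finite M"
            using finite_subset[OF J insert.hyps(1)] by (simp add: M_def)
          have "card M < Q"
          proof (rule Q[where s = "r n" and z = "x n"])
            show "\<And>a b. a \<in> M \<Longrightarrow> b \<in> M \<Longrightarrow> a \<noteq> b \<Longrightarrow>
              (r b \<le> r a \<and> \<not> ?V b \<subseteq> ?B a) \<or> (r a \<le> r b \<and> \<not> ?V a \<subseteq> ?B b)"
              using esc by (simp add: M_def)
          qed (use finM pos rn in \<open>simp_all add: M_def\<close>)
          then have "card (f ` M) < card {..<Q}"
            using card_image_le[OF finM, of f] by simp
          then have "\<not> {..<Q} \<subseteq> f ` M"
            using card_mono[of "f ` M" "{..<Q}"] finM by auto
          then obtain q where q: "q < Q" "q \<notin> f ` M"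
            by blast
          have nJ: "n \<notin> J"
            using False cov J by blast
          define f' where "f' = f(n := q)"
          have f': "f' j = f j" if "j \<in> J" for j
            using that nJ by (auto simp: f'_def)
          have f'n: "f' n = q"
            by (simp add: f'_def)
          have new: "?B j \<inter> ?B n = {}" if "j \<in> J" "f j = q" for j
            using q(2) that unfolding M_def by blast
          have out: "\<not> ?V n \<subseteq> ?B j" if "j \<in> J" for j
            using False that by blast
          show ?thesis
          proof (rule exI[of _ "insert n J"], intro conjI exI[of _ f'])
            show "insert n J \<subseteq> insert n I"
              using J by blast
            show "f' ` insert n J \<subseteq> {..<Q}"
              using f f' f'n q(1) by auto
            have "v * r n \<le> r n"
              using v pos by simp
            then have "?V n \<subseteq> ?B n"
              by (auto simp: sup_cball_def)
            then show "(\<Union>i\<in>insert n I. ?V i) \<subseteq> (\<Union>j\<in>insert n J. ?B j)"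
              using cov by blast
            show "\<forall>a\<in>insert n J. \<forall>b\<in>insert n J. a \<noteq> b \<longrightarrow> f' a = f' b \<longrightarrow> ?B a \<inter> ?B b = {}"
              using disj new f' f'n by (metis Int_commute insert_iff)
            show "\<forall>a\<in>insert n J. \<forall>b\<in>insert n J. a \<noteq> b \<longrightarrow>
              (r b \<le> r a \<and> \<not> ?V b \<subseteq> ?B a) \<or> (r a \<le> r b \<and> \<not> ?V a \<subseteq> ?B b)"
              using esc out rn by (metis insert_iff)
          qed
        qed
      qed
    qed auto
    then show ?thesis
      using that(2) by meson
  qed
  moreover have "0 < Q"
    using Q[of "{}" 1] by simp
  ultimately show ?thesis
    by (rule that)
qed


lemma closed_sup_cball: "closed (sup_cball x r)"
proof -
  have "sup_cball x r = (\<Inter>i. {y. \<bar>y $ i - x $ i\<bar> \<le> r})"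
    by (auto simp: mem_sup_cball_iff)
  moreover have "closed {y :: real ^ 'a. \<bar>y $ i - x $ i\<bar> \<le> r}" for i
    by (intro closed_Collect_le continuous_intros)
  ultimately show ?thesis
    by (simp add: closed_INT)
qed

text \<open>
  The factor \<open>sqrt d\<close> compares the supremum norm with the Euclidean norm, and \<open>2 * r\<close> is the diameter
  for the supremum norm.
\<close>

lemma sup_cball_subset_cball:
  fixes x :: "real ^ 'd"
  assumes "y \<in> sup_cball x r"
  shows "sup_cball x r \<subseteq> cball y (sqrt DIM(real ^ 'd) * (2 * r))"
proof
  fix z assume z: "z \<in> sup_cball x r"
  have "y - z = (y - x) + (x - z)"
    by simp
  then have "infnorm (y - z) \<le> infnorm (y - x) + infnorm (z - x)"
    using infnorm_triangle[of "y - x" "x - z"] infnorm_sub[of x z] by simp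
  also have "\<dots> \<le> 2 * r"
    using assms z by (simp add: sup_cball_def)
  finally have "norm (y - z) \<le> sqrt DIM(real ^ 'd) * (2 * r)"
    using norm_le_infnorm[of "y - z"] by (meson mult_left_mono order_trans real_sqrt_ge_zero of_nat_0_le_iff)
  then show "z \<in> cball y (sqrt DIM(real ^ 'd) * (2 * r))"
    by (simp add: dist_norm)
qed

section \<open>Asymptotic covering and upper limits\<close>

lemma asymptotically_covering_imp_limsup:
  fixes \<mu> :: "(real ^ 'd) measure"
  assumes "prob_space \<mu>" and sets: "sets \<mu> = sets borel"
    and B: "\<And>n. B n \<in> sets borel"
    and ac: "asymptotically_covering \<mu> B"
  shows "measure \<mu> (limsup B) = 1"
proof -
  interpret prob_space \<mu> by fact
  note [measurable_cong] = sets
  have space: "space \<mu> = UNIV"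
    using sets_eq_imp_space_eq[OF sets] by simp
  have Bm [measurable]: "B n \<in> sets \<mu>" for n
    using B sets by simp
  define U where "U g = (\<Union>n\<in>{g..}. B n)" for g
  have U [measurable]: "U g \<in> sets \<mu>" for g
    unfolding U_def by measurable
  obtain C where "C > 0" and C: "\<And>\<Omega> g. open \<Omega> \<Longrightarrow> \<exists>N. \<exists>n :: nat \<Rightarrow> nat.
       (\<forall>i\<in>{1..N}. g \<le> n i) \<and> (\<forall>i\<in>{1..N}. B (n i) \<subseteq> \<Omega>) \<and>
       measure \<mu> (\<Union>i\<in>{1..N}. B (n i)) \<ge> C * measure \<mu> \<Omega>"
    using ac unfolding asymptotically_covering_def by metis
  have "measure \<mu> (U g) = 1" for g
  proof (rule ccontr)
    assume "measure \<mu> (U g) \<noteq> 1"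
    define E where "E = - U g"
    have E [measurable]: "E \<in> sets \<mu>"
      unfolding E_def using U space by (metis Compl_eq_Diff_UNIV sets.compl_sets)
    have "measure \<mu> E = 1 - measure \<mu> (U g)"
      unfolding E_def using prob_compl[OF U] space by (simp add: Compl_eq_Diff_UNIV)
    then have Epos: "0 < measure \<mu> E"
      using \<open>measure \<mu> (U g) \<noteq> 1\<close> prob_le_1[of "U g"] by linarith
    have "emeasure \<mu> E = (INF V \<in> {V. E \<subseteq> V \<and> open V}. emeasure \<mu> V)"
      using E sets emeasure_finite by (intro outer_regular) auto
    moreover have "emeasure \<mu> E < emeasure \<mu> E + ennreal (C * measure \<mu> E)"
      using \<open>C > 0\<close> Epos emeasure_finite[of E]
      by (auto simp: emeasure_eq_measure simp flip: ennreal_plus intro!: ennreal_lessI add_pos_pos)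
    ultimately have "(INF V \<in> {V. E \<subseteq> V \<and> open V}. emeasure \<mu> V) <
        emeasure \<mu> E + ennreal (C * measure \<mu> E)"
      by simp
    then obtain V where V: "E \<subseteq> V" "open V"
      "emeasure \<mu> V < emeasure \<mu> E + ennreal (C * measure \<mu> E)"
      unfolding INF_less_iff by blast
    have "ennreal (measure \<mu> V) < ennreal (measure \<mu> E + C * measure \<mu> E)"
      using V(3) \<open>C > 0\<close> by (simp add: emeasure_eq_measure ennreal_plus)
    then have V_less: "measure \<mu> V < measure \<mu> E + C * measure \<mu> E"
      by (simp add: ennreal_less_iff)
    have Vm: "V \<in> sets \<mu>"
      using V(2) sets by simp
    obtain N and n :: "nat \<Rightarrow> nat" where n: "\<And>i. i \<in> {1..N} \<Longrightarrow> g \<le> n i"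
      "\<And>i. i \<in> {1..N} \<Longrightarrow> B (n i) \<subseteq> V"
      "measure \<mu> (\<Union>i\<in>{1..N}. B (n i)) \<ge> C * measure \<mu> V"
      using C[OF V(2), of g] by blast
    have "(\<Union>i\<in>{1..N}. B (n i)) \<subseteq> V - E"
      using n(1,2) unfolding E_def U_def by fastforce
    then have "measure \<mu> (\<Union>i\<in>{1..N}. B (n i)) \<le> measure \<mu> (V - E)"
      using Vm by (intro finite_measure_mono) auto
    also have "\<dots> = measure \<mu> V - measure \<mu> E"
      using Vm V(1) by (intro finite_measure_Diff) auto
    also have "\<dots> < C * measure \<mu> E"
      using V_less by simp
    also have "\<dots> \<le> C * measure \<mu> V"
      using \<open>C > 0\<close> V(1) Vm by (simp add: finite_measure_mono)
    finally show False
      using n(3) by simp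
  qed
  then have "AE y in \<mu>. y \<in> U g" for g
    using prob_eq_1[OF U] by blast
  then have "AE y in \<mu>. \<forall>g. y \<in> U g"
    by (simp add: AE_all_countable)
  moreover have "limsup B = (\<Inter>g. U g)"
    by (simp add: limsup_INF_SUP U_def)
  ultimately have "AE y in \<mu>. y \<in> limsup B"
    by simp
  moreover have "limsup B \<in> sets \<mu>"
    unfolding limsup_INF_SUP by measurable
  ultimately show ?thesis
    using prob_eq_1 by blast
qed

text \<open>
  Since the radii tend to \<open>0\<close>, a point of \<open>\<Omega>\<close> that lies in infinitely many dilates lies in one
  whose full cube is contained in \<open>\<Omega>\<close>; continuity from below then leaves a finite family.
\<close>

lemma finite_subfamily_half_measure:
  fixes \<mu> :: "(real ^ 'd) measure"
  assumes "prob_space \<mu>" and sets: "sets \<mu> = sets borel"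
    and rpos: "\<And>n. r n > 0" and r0: "r \<longlonglongrightarrow> 0" and "v < 1"
    and full: "measure \<mu> (limsup (\<lambda>n. sup_cball (x n) (v * r n))) = 1"
    and \<Omega>: "open \<Omega>" "0 < measure \<mu> \<Omega>"
  obtains I where "finite I" "I \<subseteq> {n. g \<le> n \<and> sup_cball (x n) (r n) \<subseteq> \<Omega>}"
    "measure \<mu> \<Omega> / 2 \<le> measure \<mu> (\<Union>n\<in>I. sup_cball (x n) (v * r n))"
proof -
  interpret prob_space \<mu> by fact
  define V where "V n = sup_cball (x n) (v * r n)" for n
  have V [measurable]: "V n \<in> sets \<mu>" for n
    unfolding V_def sets using closed_sup_cball by (rule borel_closed)
  have Om: "\<Omega> \<in> sets \<mu>"
    using \<Omega>(1) sets by simp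
  have lim: "limsup V \<in> sets \<mu>"
    unfolding limsup_INF_SUP by measurable
  define S where "S = {n. g \<le> n \<and> sup_cball (x n) (r n) \<subseteq> \<Omega>}"
  have sub: "\<Omega> \<inter> limsup V \<subseteq> (\<Union>n\<in>S. V n)"
  proof
    fix y assume y: "y \<in> \<Omega> \<inter> limsup V"
    then obtain e where e: "0 < e" "ball y e \<subseteq> \<Omega>"
      using \<Omega>(1) openE by blast
    have "(\<lambda>n. sqrt DIM(real ^ 'd) * (2 * r n)) \<longlonglongrightarrow> sqrt DIM(real ^ 'd) * (2 * 0)"
      by (intro tendsto_intros r0)
    then have "\<forall>\<^sub>F n in sequentially. sqrt DIM(real ^ 'd) * (2 * r n) < e"
      using e(1) by (intro order_tendstoD) auto
    then have "\<forall>\<^sub>F n in sequentially. g \<le> n \<and> sqrt DIM(real ^ 'd) * (2 * r n) < e"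
      using eventually_ge_at_top eventually_conj by blast
    moreover have "\<exists>\<^sub>F n in sequentially. y \<in> V n"
      using y by (simp add: mem_limsup_iff)
    ultimately obtain n where n: "y \<in> V n" "g \<le> n" "sqrt DIM(real ^ 'd) * (2 * r n) < e"
      by (metis (mono_tags, lifting) frequently_eventually_frequently frequently_ex)
    have "v * r n \<le> r n"
      using \<open>v < 1\<close> rpos[of n] by simp
    then have "y \<in> sup_cball (x n) (r n)"
      using n(1) by (auto simp: V_def sup_cball_def)
    then have "sup_cball (x n) (r n) \<subseteq> ball y e"
      using sup_cball_subset_cball n(3) by fastforce
    then show "y \<in> (\<Union>n\<in>S. V n)"
      using n e(2) by (auto simp: S_def)
  qed
  define A where "A m = (\<Union>n\<in>S \<inter> {..<m}. V n)" for m
  have "measure \<mu> \<Omega> = measure \<mu> (\<Omega> \<inter> limsup V)"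
  proof (rule finite_measure_eq_AE)
    show "AE y in \<mu>. (y \<in> \<Omega>) = (y \<in> \<Omega> \<inter> limsup V)"
      using full prob_eq_1[OF lim] unfolding V_def by auto
  qed (use Om lim in auto)
  also have "\<dots> \<le> measure \<mu> (\<Union>m. A m)"
  proof (rule finite_measure_mono)
    show "\<Omega> \<inter> limsup V \<subseteq> (\<Union>m. A m)"
      using sub by (auto simp: A_def)
  qed (auto simp: A_def)
  finally have "measure \<mu> \<Omega> / 2 < measure \<mu> (\<Union>m. A m)"
    using \<Omega>(2) by simp
  moreover have "(\<lambda>m. measure \<mu> (A m)) \<longlonglongrightarrow> measure \<mu> (\<Union>m. A m)"
    by (rule finite_Lim_measure_incseq) (auto simp: A_def incseq_def)
  ultimately obtain m where "measure \<mu> \<Omega> / 2 < measure \<mu> (A m)"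
    by (metis (no_types, lifting) eventually_sequentially order_refl order_tendstoD(1))
  then show ?thesis
    using that[of "S \<inter> {..<m}"] by (auto simp: S_def A_def V_def)
qed

lemma limsup_imp_asymptotically_covering:
  fixes \<mu> :: "(real ^ 'd) measure"
  assumes "prob_space \<mu>" and sets: "sets \<mu> = sets borel"
    and rpos: "\<And>n. r n > 0" and r0: "r \<longlonglongrightarrow> 0" and v: "v < 1"
    and full: "measure \<mu> (limsup (\<lambda>n. sup_cball (x n) (v * r n))) = 1"
  shows "asymptotically_covering \<mu> (\<lambda>n. sup_cball (x n) (r n))"
proof -
  interpret prob_space \<mu> by fact
  let ?B = "\<lambda>n. sup_cball (x n) (r n)"
  have B [measurable]: "?B n \<in> sets \<mu>" for n
    unfolding sets using closed_sup_cball by (rule borel_closed)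
  obtain Q :: nat where Q: "\<And>(x :: nat \<Rightarrow> real ^ 'd) r I.
       finite I \<Longrightarrow> (\<And>i. i \<in> I \<Longrightarrow> 0 < r i) \<Longrightarrow>
       \<exists>J\<subseteq>I. \<exists>f :: nat \<Rightarrow> nat. f ` J \<subseteq> {..<Q} \<and>
         (\<Union>i\<in>I. sup_cball (x i) (v * r i)) \<subseteq> (\<Union>j\<in>J. sup_cball (x j) (r j)) \<and>
         (\<forall>a\<in>J. \<forall>b\<in>J. a \<noteq> b \<longrightarrow> f a = f b \<longrightarrow>
            sup_cball (x a) (r a) \<inter> sup_cball (x b) (r b) = {})"
    and "0 < Q"
    by (rule finite_Besicovitch_dilated[OF v]) (erule that, assumption)
  define C :: real where "C = 1 / (2 * Q)"
  have "\<exists>N. \<exists>n :: nat \<Rightarrow> nat.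
       (\<forall>i\<in>{1..N}. g \<le> n i) \<and> mono_on {1..N} n \<and>
       (\<forall>i\<in>{1..N}. ?B (n i) \<subseteq> \<Omega>) \<and>
       (\<forall>i\<in>{1..N}. \<forall>j\<in>{1..N}. i \<noteq> j \<longrightarrow> ?B (n i) \<inter> ?B (n j) = {}) \<and>
       measure \<mu> (\<Union>i\<in>{1..N}. ?B (n i)) \<ge> C * measure \<mu> \<Omega>"
    if \<Omega>: "open \<Omega>" for \<Omega> g
  proof (cases "measure \<mu> \<Omega> = 0")
    case True
    then show ?thesis
      by (intro exI[of _ 0]) auto
  next
    case False
    then have "0 < measure \<mu> \<Omega>"
      by (simp add: zero_less_measure_iff)
    with \<Omega> obtain I where I: "finite I" "I \<subseteq> {n. g \<le> n \<and> ?B n \<subseteq> \<Omega>}"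
      "measure \<mu> \<Omega> / 2 \<le> measure \<mu> (\<Union>n\<in>I. sup_cball (x n) (v * r n))"
      by (rule finite_subfamily_half_measure[OF \<open>prob_space \<mu>\<close> sets rpos r0 v full])
    obtain J and f :: "nat \<Rightarrow> nat" where J: "J \<subseteq> I" and f: "f ` J \<subseteq> {..<Q}"
      and cov: "(\<Union>n\<in>I. sup_cball (x n) (v * r n)) \<subseteq> (\<Union>j\<in>J. ?B j)"
      and disj: "\<forall>a\<in>J. \<forall>b\<in>J. a \<noteq> b \<longrightarrow> f a = f b \<longrightarrow> ?B a \<inter> ?B b = {}"
      using Q[OF I(1), of r x, OF rpos] by (elim exE conjE) (rule that)
    have finJ: "finite J"
      using J I(1) finite_subset by blast
    define K where "K q = {j \<in> J. f j = q}" for q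
    have "measure \<mu> \<Omega> / 2 \<le> measure \<mu> (\<Union>q<Q. \<Union>j\<in>K q. ?B j)"
    proof (rule order_trans[OF I(3)], rule finite_measure_mono)
      show "(\<Union>n\<in>I. sup_cball (x n) (v * r n)) \<subseteq> (\<Union>q<Q. \<Union>j\<in>K q. ?B j)"
        using cov f by (force simp: K_def)
    qed (use finJ in \<open>auto simp: K_def\<close>)
    also have "\<dots> \<le> (\<Sum>q<Q. measure \<mu> (\<Union>j\<in>K q. ?B j))"
      using finJ by (intro measure_UNION_le) (auto simp: K_def)
    finally have "\<exists>q<Q. C * measure \<mu> \<Omega> \<le> measure \<mu> (\<Union>j\<in>K q. ?B j)"
    proof (rule contrapos_pp)
      assume "\<not> (\<exists>q<Q. C * measure \<mu> \<Omega> \<le> measure \<mu> (\<Union>j\<in>K q. ?B j))"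
      then have "(\<Sum>q<Q. measure \<mu> (\<Union>j\<in>K q. ?B j)) < (\<Sum>q<Q. C * measure \<mu> \<Omega>)"
        using \<open>0 < Q\<close> by (intro sum_strict_mono) (auto simp: not_le)
      also have "\<dots> = measure \<mu> \<Omega> / 2"
        using \<open>0 < Q\<close> by (simp add: C_def)
      finally show "\<not> measure \<mu> \<Omega> / 2 \<le> (\<Sum>q<Q. measure \<mu> (\<Union>j\<in>K q. ?B j))"
        by simp
    qed
    then obtain q where q: "C * measure \<mu> \<Omega> \<le> measure \<mu> (\<Union>j\<in>K q. ?B j)"
      by blast
    obtain h where h: "bij_betw h {..<card (K q)} (K q)" "strict_mono_on {..<card (K q)} h"
      using ex_bij_betw_strict_mono_card[of "K q"] finJ by (auto simp: K_def)
    define N where "N = card (K q)"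
    \<comment> \<open>The enumeration \<open>h\<close> starts at \<open>0\<close>, the required family at \<open>1\<close>.\<close>
    define n where "n i = h (i - 1)" for i
    have n_mem: "n i \<in> K q" if "i \<in> {1..N}" for i
      using bij_betwE[OF h(1)] that by (auto simp: n_def N_def)
    have n_less: "n i < n j" if "i \<in> {1..N}" "j \<in> {1..N}" "i < j" for i j
      unfolding n_def using that by (intro strict_mono_onD[OF h(2)]) (auto simp: N_def)
    have n_inj: "n i \<noteq> n j" if "i \<in> {1..N}" "j \<in> {1..N}" "i \<noteq> j" for i j
      using n_less that by (metis nat_neq_iff)
    have n_image: "n ` {1..N} = K q"
      using bij_betw_imp_surj_on[OF h(1)] image_Suc_lessThan[of N, symmetric]
      by (simp add: n_def N_def image_image)
    show ?thesis
    proof (rule exI[of _ N], rule exI[of _ n], intro conjI ballI impI)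
      show "mono_on {1..N} n"
        using n_less by (auto intro!: mono_onI simp: order_le_less)
      show "g \<le> n i" "?B (n i) \<subseteq> \<Omega>" if "i \<in> {1..N}" for i
        using n_mem[OF that] J I(2) by (auto simp: K_def)
      show "?B (n i) \<inter> ?B (n j) = {}" if "i \<in> {1..N}" "j \<in> {1..N}" "i \<noteq> j" for i j
        using n_mem[OF that(1)] n_mem[OF that(2)] n_inj[OF that] disj by (auto simp: K_def)
      have "(\<Union>i\<in>{1..N}. ?B (n i)) = (\<Union>j\<in>K q. ?B j)"
        unfolding n_image[symmetric] by (simp add: image_image)
      then show "C * measure \<mu> \<Omega> \<le> measure \<mu> (\<Union>i\<in>{1..N}. ?B (n i))"
        using q by simp
    qed
  qed
  moreover have "C > 0"
    using \<open>0 < Q\<close> by (simp add: C_def)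
  ultimately show ?thesis
    unfolding asymptotically_covering_def by blast
qed

theorem theorem2p1:
  fixes \<mu> :: "(real ^ 'd) measure"
    and x :: "nat \<Rightarrow> real ^ 'd"
    and r :: "nat \<Rightarrow> real"
  assumes "prob_space \<mu>"
    and "sets \<mu> = sets borel"
    and "\<And>n. r n > 0"
    and "r \<longlonglongrightarrow> 0"
  shows "(asymptotically_covering \<mu> (\<lambda>n. sup_cball (x n) (r n)) \<longrightarrow>
            measure \<mu> (limsup (\<lambda>n. sup_cball (x n) (r n))) = 1) \<and>
         ((\<exists>v. 0 \<le> v \<and> v < 1 \<and>
             measure \<mu> (limsup (\<lambda>n. sup_cball (x n) (v * r n))) = 1) \<longrightarrow>
            asymptotically_covering \<mu> (\<lambda>n. sup_cball (x n) (r n)))"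
proof (intro conjI impI)
  have "sup_cball (x n) (r n) \<in> sets borel" for n
    using closed_sup_cball by (rule borel_closed)
  moreover assume "asymptotically_covering \<mu> (\<lambda>n. sup_cball (x n) (r n))"
  ultimately show "measure \<mu> (limsup (\<lambda>n. sup_cball (x n) (r n))) = 1"
    by (rule asymptotically_covering_imp_limsup[OF assms(1,2)])
next
  assume "\<exists>v. 0 \<le> v \<and> v < 1 \<and> measure \<mu> (limsup (\<lambda>n. sup_cball (x n) (v * r n))) = 1"
  then obtain v where "v < 1" "measure \<mu> (limsup (\<lambda>n. sup_cball (x n) (v * r n))) = 1"
    by (elim exE conjE)
  then show "asymptotically_covering \<mu> (\<lambda>n. sup_cball (x n) (r n))"
    by (rule limsup_imp_asymptotically_covering[OF assms])
qed

end
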